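(* Let $\mathcal{X}$ be a compact Polish space, $\mathcal{L}:\mathcal{X}\to[-\infty,\infty)$ upper semicontinuous, $P\in\mathcal{P}(\mathcal{X})$, $D$ a pre-divergence such that $Q\mapsto D(Q\|P)$ is lower semicontinuous and $D(\mu_n\|P)\to0$ implies $\mu_n\to P$ weakly, and $c$ a cost function. For $r>0$ let $c_r=rc$. Then for every $\epsilon>0$, \[\lim_{r\to0^+}\sup_{Q:D^{c_r}(Q\|P)\leq r\epsilon}E_Q[\mathcal{L}]=\sup_{Q:C(P,Q)\leq\epsilon}E_Q[\mathcal{L}].\] Moreover, if $\{\mathcal{L}_\theta\}_{\theta\in\Theta}$ is a family of upper semicontinuous functions $\mathcal{X}\to[-\infty,\infty)$, then \[\lim_{r\to0^+}\inf_{\theta\in\Theta}\sup_{Q:D^{c_r}(Q\|P)\leq r\epsilon}E_Q[\mathcal{L}_\theta]=\inf_{\theta\in\Theta}\sup_{Q:C(P,Q)\leq\epsilon}E_Q[\mathcal{L}_\theta].\]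
   Context: $\mathcal{P}(\mathcal{X})$ is the set of Borel probability measures on $\mathcal{X}$ with the weak topology; suprema are over $Q\in\mathcal{P}(\mathcal{X})$. A pre-divergence is $D:\mathcal{P}(\mathcal{X})\times\mathcal{P}(\mathcal{X})\to[0,\infty]$ with $D(\mu\|\mu)=0$ for all $\mu$. A cost function is a lower semicontinuous $c:\mathcal{X}\times\mathcal{X}\to[0,\infty]$, with OT cost $C(\mu,\nu)=\inf\{\int c\,d\pi:\pi\in\mathcal{P}(\mathcal{X}\times\mathcal{X}),\pi_1=\mu,\pi_2=\nu\}$. For a cost function $c'$ with OT cost $C'$, $D^{c'}(\nu\|\mu)=\inf_{\eta\in\mathcal{P}(\mathcal{X})}\{D(\eta\|\mu)+C'(\eta,\nu)\}$. *)

theory Defs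
  imports "HOL-Probability.Probability"
begin

definition prob_measures :: "'a::topological_space measure set" where
  "prob_measures = {M. sets M = sets borel \<and> prob_space M}"

definition weak_conv_seq :: "(nat \<Rightarrow> 'a::topological_space measure) \<Rightarrow> 'a measure \<Rightarrow> bool" where
  "weak_conv_seq \<mu>s \<mu> \<longleftrightarrow>
     (\<forall>f :: 'a \<Rightarrow> real. continuous_on UNIV f \<and> bounded (range f) \<longrightarrow>
        (\<lambda>n. \<integral>x. f x \<partial>\<mu>s n) \<longlonglongrightarrow> (\<integral>x. f x \<partial>\<mu>))"

definition lsc_fun :: "('a::topological_space \<Rightarrow> 'b::linorder) \<Rightarrow> bool" where
  "lsc_fun f \<longleftrightarrow> (\<forall>t. closed {x. f x \<le> t})"

definition usc_fun :: "('a::topological_space \<Rightarrow> 'b::linorder) \<Rightarrow> bool" where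
  "usc_fun f \<longleftrightarrow> (\<forall>t. closed {x. t \<le> f x})"

definition pre_divergence :: "('a::topological_space measure \<Rightarrow> 'a measure \<Rightarrow> ennreal) \<Rightarrow> bool" where
  "pre_divergence D \<longleftrightarrow> (\<forall>\<mu>\<in>prob_measures. D \<mu> \<mu> = 0)"

definition couplings :: "'a::topological_space measure \<Rightarrow> 'a measure \<Rightarrow> ('a \<times> 'a) measure set" where
  "couplings \<mu> \<nu> = {\<pi>. sets \<pi> = sets (borel :: ('a \<times> 'a) measure) \<and> prob_space \<pi> \<and>
       distr \<pi> borel fst = \<mu> \<and> distr \<pi> borel snd = \<nu>}"

definition OT_cost :: "('a::topological_space \<Rightarrow> 'a \<Rightarrow> ennreal) \<Rightarrow> 'a measure \<Rightarrow> 'a measure \<Rightarrow> ennreal" where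
  "OT_cost c \<mu> \<nu> = (INF \<pi>\<in>couplings \<mu> \<nu>. \<integral>\<^sup>+ z. c (fst z) (snd z) \<partial>\<pi>)"

definition D_cost :: "('a::topological_space measure \<Rightarrow> 'a measure \<Rightarrow> ennreal) \<Rightarrow> ('a \<Rightarrow> 'a \<Rightarrow> ennreal)
     \<Rightarrow> 'a measure \<Rightarrow> 'a measure \<Rightarrow> ennreal" where
  "D_cost D c' \<nu> \<mu> = (INF \<eta>\<in>prob_measures. D \<eta> \<mu> + OT_cost c' \<eta> \<nu>)"

definition ereal_expect :: "'a measure \<Rightarrow> ('a \<Rightarrow> ereal) \<Rightarrow> ereal" where
  "ereal_expect Q L = enn2ereal (\<integral>\<^sup>+ x. e2ennreal (L x) \<partial>Q) - enn2ereal (\<integral>\<^sup>+ x. e2ennreal (- L x) \<partial>Q)"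

end

theory Submission
  imports Defs
begin

text \<open>
  If \<open>C(P,Q) \<le> \<epsilon>\<close>, the competitor \<open>\<eta> = P\<close> shows that \<open>Q\<close> lies in every ball
  \<open>D\<^sup>c\<^sup>r(Q\<parallel>P) \<le> r\<epsilon>\<close>, so the limit is at least the optimal transport supremum.
  Conversely, for \<open>Q\<^sub>n\<close> in the balls of parameters \<open>r\<^sub>n \<rightarrow> 0\<close> there are \<open>\<eta>\<^sub>n\<close> with
  \<open>D(\<eta>\<^sub>n\<parallel>P) \<rightarrow> 0\<close>, hence \<open>\<eta>\<^sub>n \<rightarrow> P\<close>, and couplings of \<open>\<eta>\<^sub>n\<close> and \<open>Q\<^sub>n\<close> of cost at most
  \<open>\<epsilon> + 1/(n+1)\<close>. By compactness these couplings subconverge weakly, to a coupling of \<open>P\<close> with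
  some \<open>Q\<close>, of cost at most \<open>\<epsilon>\<close> by lower semicontinuity; and \<open>E\<^sub>Q[L]\<close> is upper semicontinuous
  in \<open>Q\<close>. The infimum over \<open>\<theta>\<close> passes to the limit because each supremum converges from above.

  Weak sequential compactness is reduced to Helly's theorem on the real line by a Borel injection
  \<open>s\<close> of the compact space into the reals whose inverse extends continuously to the
  closure of the range of \<open>s\<close>.
\<close>

section \<open>Coding a compact metric space by real numbers\<close>

text \<open>At the first index \<open>k\<close> with different digits the terms differ by
  \<open>1 / 3 ^ k\<close>, while all later terms together contribute at most half of that,
  \<open>1 / (2 * 3 ^ k)\<close>. So the sums differ by at least \<open>1 / (2 * 3 ^ k)\<close>,
  which contradicts closeness if \<open>k \<le> m\<close>. In base 2 the tail could cancel the
  leading difference; base 3 leaves a gap.\<close>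

lemma ternary_expansion_close:
  fixes a b :: "nat \<Rightarrow> real"
  assumes a: "\<And>i. a i \<in> {0, 1}" and b: "\<And>i. b i \<in> {0, 1}"
    and close: "\<bar>(\<Sum>i. a i / 3 ^ i) - (\<Sum>i. b i / 3 ^ i)\<bar> < 1 / (2 * 3 ^ m)"
    and "i \<le> m"
  shows "a i = b i"
proof (rule ccontr)
  assume "a i \<noteq> b i"
  define k where "k = (LEAST j. a j \<noteq> b j)"
  have k: "a k \<noteq> b k"
    unfolding k_def using \<open>a i \<noteq> b i\<close> by (rule LeastI)
  have kle: "k \<le> i"
    unfolding k_def using \<open>a i \<noteq> b i\<close> by (rule Least_le)
  have below: "a j = b j" if "j < k" for j
    using not_less_Least[OF that[unfolded k_def]] by simp
  define d where "d j = (a j - b j) / 3 ^ j" for j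
  have geo: "summable (\<lambda>j. 1 / (3::real) ^ j)"
    using summable_geometric[of "1/3::real"] by (simp add: power_divide)
  have a1: "\<bar>a j\<bar> \<le> 1" and b1: "\<bar>b j\<bar> \<le> 1" and ab1: "\<bar>a j - b j\<bar> \<le> 1" for j
    using a[of j] b[of j] by auto
  have sa: "summable (\<lambda>j. a j / 3 ^ j)" and sb: "summable (\<lambda>j. b j / 3 ^ j)"
    by (rule summable_comparison_test'[OF geo, of 0], use a1 b1 in \<open>simp add: divide_right_mono\<close>)+
  have dle: "norm (d j) \<le> 1 / 3 ^ j" for j
    using ab1[of j] by (simp add: d_def divide_right_mono)
  have sd: "summable d"
    by (rule summable_comparison_test'[OF geo, of 0]) (use dle in simp)
  have eq: "(\<Sum>i. a i / 3 ^ i) - (\<Sum>i. b i / 3 ^ i) = suminf d"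
    unfolding d_def using suminf_diff[OF sa sb] by (simp add: diff_divide_distrib)
  have "suminf d = (\<Sum>n. d (n + Suc k)) + sum d {..<Suc k}"
    by (rule suminf_split_initial_segment[OF sd])
  also have "sum d {..<Suc k} = d k"
    using below by (simp add: d_def)
  finally have split: "suminf d = (\<Sum>n. d (n + Suc k)) + d k" .
  have tail: "\<bar>\<Sum>n. d (n + Suc k)\<bar> \<le> (\<Sum>n. 1 / 3 ^ Suc k * (1 / 3) ^ n)"
  proof (subst real_norm_def[symmetric], rule norm_suminf_le)
    show "norm (d (n + Suc k)) \<le> 1 / 3 ^ Suc k * (1 / 3) ^ n" for n
      using dle[of "n + Suc k"] by (simp add: power_add power_divide mult_ac)
    show "summable (\<lambda>n. 1 / 3 ^ Suc k * (1 / 3 :: real) ^ n)"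
      by (intro summable_mult summable_geometric) simp
  qed
  also have "\<dots> = 1 / (2 * 3 ^ k)"
    by (subst suminf_mult) (auto simp: suminf_geometric)
  finally have tail': "\<bar>\<Sum>n. d (n + Suc k)\<bar> \<le> 1 / (2 * 3 ^ k)" .
  have "\<bar>d k\<bar> = 1 / 3 ^ k"
    using k a[of k] b[of k] by (auto simp: d_def)
  also have "\<dots> = 1 / (2 * 3 ^ k) + 1 / (2 * 3 ^ k)"
    by (simp add: field_simps)
  finally have "\<bar>suminf d\<bar> \<ge> 1 / (2 * 3 ^ k)"
    using tail' split by linarith
  moreover have "1 / (2 * 3 ^ m) \<le> 1 / (2 * 3 ^ k :: real)"
    using kle \<open>i \<le> m\<close> by (intro divide_left_mono mult_left_mono power_increasing) auto
  ultimately show False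
    using close eq by linarith
qed

text \<open>The code of a point has as ternary digits its memberships in the sets of a countable
  base. By compactness finitely many digits locate a point up to any given error, so decoding is
  uniformly continuous on the range of \<open>s\<close> and extends to its closure, which serves as
  \<open>K\<close>.\<close>

lemma compact_space_real_coding:
  assumes compact: "compact (UNIV :: 'a::{complete_space,second_countable_topology} set)"
  obtains s :: "'a::{complete_space,second_countable_topology} \<Rightarrow> real" and p K
  where "s \<in> borel_measurable borel" "compact K" "range s \<subseteq> K" "continuous_on K p" "\<And>x. p (s x) = x"
proof -
  obtain B :: "'a set set" where B: "countable B" "topological_basis B"
    using ex_countable_basis by blast
  have "B \<noteq> {}"
    using topological_basisE[OF B(2) open_UNIV UNIV_I] by blast
  define U where "U = from_nat_into B"
  have UB: "range U = B"
    unfolding U_def using B \<open>B \<noteq> {}\<close> by (simp add: range_from_nat_into)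
  have U_open: "open (U i)" for i
    using UB B(2) topological_basis_open by blast
  \<comment> \<open>The base sets contained in balls of radius \<open>e / 2\<close> cover the space;
    the largest index in a finite subcover serves as \<open>m\<close>.\<close>
  have modulus: "\<exists>m. \<forall>y y'. (\<forall>i\<le>m. y \<in> U i \<longleftrightarrow> y' \<in> U i) \<longrightarrow> dist y y' < e" if "e > 0" for e
  proof -
    have "\<exists>i. x \<in> U i \<and> U i \<subseteq> ball x (e / 2)" for x
    proof -
      obtain V where "V \<in> B" "x \<in> V" "V \<subseteq> ball x (e / 2)"
        using topological_basisE[OF B(2) open_ball, of x x "e / 2"] \<open>e > 0\<close> by auto
      then show ?thesis using UB by blast
    qed
    then obtain i where i: "\<And>x. x \<in> U (i x)" "\<And>x. U (i x) \<subseteq> ball x (e / 2)"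
      by metis
    obtain C where C: "finite C" "UNIV \<subseteq> (\<Union>x\<in>C. U (i x))"
      by (rule compactE_image[OF compact, of UNIV "\<lambda>x. U (i x)"]) (use U_open i(1) in auto)
    show ?thesis
    proof (intro exI[of _ "Max (i ` C)"] allI impI)
      fix y y' assume same: "\<forall>j\<le>Max (i ` C). y \<in> U j \<longleftrightarrow> y' \<in> U j"
      obtain x where x: "x \<in> C" "y \<in> U (i x)" using C(2) by blast
      moreover have "i x \<le> Max (i ` C)" using x(1) C(1) by auto
      ultimately have "y' \<in> U (i x)" using same by blast
      then have "dist x y < e / 2" "dist x y' < e / 2"
        using x(2) i(2)[of x] by auto
      then show "dist y y' < e"
        by (metis dist_commute dist_triangle_half_r)
    qed
  qed
  \<comment> \<open>\<open>s\<close> itself is discontinuous; only its inverse has to be uniformly continuous, and it is: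
    close values of \<open>s\<close> force agreement on the first sets \<open>U i\<close>.\<close>
  define s :: "'a \<Rightarrow> real" where "s y = (\<Sum>i. indicator (U i) y / 3 ^ i)" for y
  have s_meas: "s \<in> borel_measurable borel"
    unfolding s_def using U_open by (intro borel_measurable_suminf) measurable
  have s_modulus: "\<exists>\<delta>>0. \<forall>y y'. \<bar>s y - s y'\<bar> < \<delta> \<longrightarrow> dist y y' < e" if e: "e > 0" for e
  proof -
    obtain m where m: "\<And>y y'. (\<forall>i\<le>m. y \<in> U i \<longleftrightarrow> y' \<in> U i) \<Longrightarrow> dist y y' < e"
      using modulus[OF e] by blast
    have "dist y y' < e" if "\<bar>s y - s y'\<bar> < 1 / (2 * 3 ^ m)" for y y'
    proof (rule m, intro allI impI)
      fix i assume "i \<le> m"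
      have "indicator (U i) y = (indicator (U i) y' :: real)"
        by (rule ternary_expansion_close[of "\<lambda>i. indicator (U i) y" "\<lambda>i. indicator (U i) y'" m])
           (use that \<open>i \<le> m\<close> in \<open>auto simp: s_def indicator_def\<close>)
      then show "y \<in> U i \<longleftrightarrow> y' \<in> U i"
        by (auto simp: indicator_def split: if_splits)
    qed
    then show ?thesis
      by (intro exI[of _ "1 / (2 * 3 ^ m)"]) auto
  qed
  have inj: "inj s"
  proof (rule injI)
    fix x y assume xy: "s x = s y"
    have "dist x y < e" if "e > 0" for e
      using s_modulus[OF that] xy by auto
    then show "x = y"
      by (metis less_irrefl zero_less_dist_iff)
  qed
  have "uniformly_continuous_on (range s) (inv s)"
    unfolding uniformly_continuous_on_def
  proof (intro allI impI)
    fix e :: real assume "e > 0"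
    from s_modulus[OF this] obtain \<delta> where "\<delta> > 0" "\<And>y y'. \<bar>s y - s y'\<bar> < \<delta> \<Longrightarrow> dist y y' < e"
      by blast
    then show "\<exists>d>0. \<forall>x\<in>range s. \<forall>x'\<in>range s. dist x' x < d \<longrightarrow> dist (inv s x') (inv s x) < e"
      by (intro exI[of _ \<delta>]) (auto simp: inv_f_f[OF inj] dist_real_def)
  qed
  then obtain p where p: "uniformly_continuous_on (closure (range s)) p"
      "\<And>x. x \<in> range s \<Longrightarrow> inv s x = p x"
    using uniformly_continuous_on_extension_on_closure by metis
  have geo: "summable (\<lambda>j. 1 / (3::real) ^ j)"
    using summable_geometric[of "1/3::real"] by (simp add: power_divide)
  have "norm (s y) \<le> (\<Sum>j. 1 / 3 ^ j)" for y
    unfolding s_def by (rule norm_suminf_le[OF _ geo]) (simp add: indicator_def)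
  then have "bounded (range s)"
    by (intro boundedI[where B="\<Sum>j. 1 / 3 ^ j"]) auto
  then have "compact (closure (range s))"
    by (simp add: compact_closure)
  then show ?thesis
  proof (rule that[OF s_meas])
    show "range s \<subseteq> closure (range s)" by (rule closure_subset)
    show "continuous_on (closure (range s)) p" by (rule uniformly_continuous_imp_continuous[OF p(1)])
    show "p (s x) = x" for x using p(2)[of "s x"] inv_f_f[OF inj, of x] by simp
  qed
qed

section \<open>Weak sequential compactness of the probability measures\<close>

lemma prob_measures_distr:
  assumes "\<mu> \<in> prob_measures" "f \<in> borel_measurable borel"
  shows "distr \<mu> borel f \<in> prob_measures"
  using assms by (auto simp: prob_measures_def intro!: prob_space.prob_space_distr cong: measurable_cong_sets)

text \<open>The images under \<open>s\<close> all live on the bounded set \<open>K\<close>, hence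
  are tight, and a subsequence converges weakly on the line to some \<open>M\<close>. This limit is
  again carried by \<open>K\<close>, so it can be transported back by \<open>p\<close>.\<close>

lemma prob_measures_weak_seq_compact:
  fixes \<mu>s :: "nat \<Rightarrow> 'a::{complete_space,second_countable_topology} measure"
  assumes compact: "compact (UNIV :: 'a set)" and \<mu>s: "\<And>n. \<mu>s n \<in> prob_measures"
  obtains r \<mu> where "strict_mono r" "\<mu> \<in> prob_measures" "weak_conv_seq (\<lambda>n. \<mu>s (r n)) \<mu>"
proof -
  obtain s :: "'a \<Rightarrow> real" and p K where s[measurable]: "s \<in> borel_measurable borel"
      and K: "compact K" "range s \<subseteq> K" and p: "continuous_on K p" "\<And>x. p (s x) = x"
    using compact_space_real_coding[OF compact] by metis
  have K_closed: "closed K" using K(1) by (rule compact_imp_closed)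
  have sK: "s x \<in> K" for x using K(2) by blast
  have sets_\<mu>s[measurable_cong]: "sets (\<mu>s n) = sets borel" for n
    using \<mu>s by (auto simp: prob_measures_def)
  define \<nu> where "\<nu> n = distr (\<mu>s n) borel s" for n
  have \<nu>: "real_distribution (\<nu> n)" for n
    using prob_measures_distr[OF \<mu>s s, of n]
    by (auto simp: prob_measures_def real_distribution_def real_distribution_axioms_def \<nu>_def)
  obtain b where b: "b > 0" "\<And>t. t \<in> K \<Longrightarrow> \<bar>t\<bar> < b"
    using compact_imp_bounded[OF K(1)] by (auto simp: bounded_pos_less)
  have "measure (\<nu> n) {- b<..b} = 1" for n
  proof -
    interpret prob_space "\<mu>s n" using \<mu>s by (auto simp: prob_measures_def)
    have "s x \<in> {- b<..b}" for x using b(2)[OF sK[of x]] by auto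
    then have "s -` {- b<..b} \<inter> space (\<mu>s n) = space (\<mu>s n)" by auto
    then show ?thesis
      unfolding \<nu>_def by (subst measure_distr) (auto simp: prob_space)
  qed
  then have "tight \<nu>"
    unfolding tight_def using \<nu> b(1) by (intro conjI allI impI exI[of _ "- b"] exI[of _ b]) auto
  from tight_imp_convergent_subsubsequence[OF this strict_mono_id]
  obtain r M where r: "strict_mono r" and M: "real_distribution M" and conv: "weak_conv_m (\<nu> \<circ> id \<circ> r) M"
    by blast
  interpret M: real_distribution M by (rule M)
  have lim: "(\<lambda>n. integral\<^sup>L (\<nu> (r n)) g) \<longlonglongrightarrow> integral\<^sup>L M g"
    if "continuous_on UNIV g" "\<And>t. \<bar>g t\<bar> \<le> B" for g :: "real \<Rightarrow> real" and B
    using weak_conv_imp_integral_bdd_continuous_conv[OF _ M conv, of g B] \<nu> that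
    by (simp add: continuous_on_eq_continuous_at o_def)
  have distr_int: "integral\<^sup>L (\<nu> n) g = (\<integral>x. g (s x) \<partial>\<mu>s n)" if "continuous_on UNIV g" for g :: "real \<Rightarrow> real" and n
    unfolding \<nu>_def using borel_measurable_continuous_onI[OF that] by (intro integral_distr) measurable
  \<comment> \<open>The truncated distance to \<open>K\<close> is a bounded continuous test function
    with integral 0 along the sequence, hence also under \<open>M\<close>; it vanishes only on
    \<open>K\<close>, as \<open>K\<close> is closed.\<close>
  have AE_K: "AE t in M. t \<in> K"
  proof -
    define g where "g t = min 1 (infdist t K)" for t
    have g: "continuous_on UNIV g" "\<And>t. 0 \<le> g t"
      by (auto simp: g_def intro!: continuous_intros infdist_nonneg)
    have g_le: "\<bar>g t\<bar> \<le> 1" for t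
      using g(2)[of t] by (simp add: g_def)
    have gm: "g \<in> borel_measurable borel" using g(1) by (rule borel_measurable_continuous_onI)
    have "integral\<^sup>L (\<nu> n) g = 0" for n
      using sK by (subst distr_int[OF g(1)]) (simp add: g_def)
    with lim[OF g(1) g_le] have "integral\<^sup>L M g = 0"
      by (simp add: LIMSEQ_const_iff)
    moreover have "integrable M g"
      using gm g_le by (intro M.integrable_const_bound[where B=1]) (auto simp: M.events_eq_borel cong: measurable_cong_sets)
    ultimately have "AE t in M. g t = 0"
      using g(2) by (subst (asm) integral_nonneg_eq_0_iff_AE) auto
    then show ?thesis
    proof eventually_elim
      case (elim t)
      then have "infdist t K = 0" by (auto simp: g_def min_def split: if_splits)
      moreover have "K \<noteq> {}" using sK by blast
      ultimately show ?case using K_closed in_closed_iff_infdist_zero by blast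
    qed
  qed
  \<comment> \<open>Only values on \<open>K\<close> matter, since \<open>M\<close> gives its
    complement mass 0; the constant outside makes the map Borel on the whole line.\<close>
  define p' where "p' t = (if t \<in> K then p t else undefined)" for t
  have p'[measurable]: "p' \<in> borel_measurable borel"
    unfolding p'_def using K_closed p(1) by (intro borel_measurable_continuous_on_if) auto
  define \<mu> where "\<mu> = distr M borel p'"
  have "M \<in> prob_measures" using M.prob_space_axioms by (simp add: prob_measures_def)
  then have "\<mu> \<in> prob_measures"
    unfolding \<mu>_def using p' by (rule prob_measures_distr)
  moreover have "weak_conv_seq (\<lambda>n. \<mu>s (r n)) \<mu>"
    unfolding weak_conv_seq_def
  proof (intro allI impI, elim conjE)
    fix f :: "'a \<Rightarrow> real" assume f: "continuous_on UNIV f" "bounded (range f)"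
    have fm[measurable]: "f \<in> borel_measurable borel" using f(1) by (rule borel_measurable_continuous_onI)
    obtain B where B: "B > 0" "\<And>x. norm (f x) \<le> B" using f(2) by (auto simp: bounded_pos)
    \<comment> \<open>Weak convergence on the line tests functions on all reals, so
      \<open>f \<circ> p\<close> is extended from \<open>K\<close> by Tietze, with the same bound
      \<open>B\<close>.\<close>
    have "continuous_on K (\<lambda>t. f (p t))"
      by (rule continuous_on_compose2[OF f(1) p(1)]) auto
    then obtain g where g: "continuous_on UNIV g" "\<And>t. t \<in> K \<Longrightarrow> g t = f (p t)" "\<And>t. norm (g t) \<le> B"
      using Tietze[of K "\<lambda>t. f (p t)" UNIV B] K_closed B by auto
    have gm: "g \<in> borel_measurable borel" using g(1) by (rule borel_measurable_continuous_onI)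
    have "integral\<^sup>L (\<nu> (r n)) g = integral\<^sup>L (\<mu>s (r n)) f" for n
      using sK p(2) g(2) by (subst distr_int[OF g(1)]) simp
    moreover have "integral\<^sup>L M g = integral\<^sup>L \<mu> f"
    proof -
      have "integral\<^sup>L \<mu> f = (\<integral>t. f (p' t) \<partial>M)"
        unfolding \<mu>_def by (rule integral_distr) measurable
      also have "\<dots> = integral\<^sup>L M g"
      proof (rule integral_cong_AE)
        show "AE t in M. f (p' t) = g t"
          using AE_K by eventually_elim (simp add: p'_def g(2))
      qed (use gm in measurable)
      finally show ?thesis ..
    qed
    ultimately show "(\<lambda>n. integral\<^sup>L (\<mu>s (r n)) f) \<longlonglongrightarrow> integral\<^sup>L \<mu> f"
      using lim[OF g(1), of B] g(3) by simp
  qed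
  ultimately show ?thesis using that r by blast
qed

section \<open>Portmanteau inequality, uniqueness and images of weak limits\<close>

text \<open>The indicator of \<open>U\<close> is the pointwise limit from below of continuous
  functions \<open>f k\<close> with values in [0,1]. For fixed \<open>k\<close> the integral of
  \<open>f k\<close> passes to the weak limit and is bounded by the mass of \<open>U\<close>; then
  \<open>k\<close> tends to infinity.\<close>

lemma portmanteau_open:
  fixes \<mu> :: "'a::metric_space measure"
  assumes \<mu>s: "\<And>n. \<mu>s n \<in> prob_measures" and \<mu>: "\<mu> \<in> prob_measures"
    and conv: "weak_conv_seq \<mu>s \<mu>" and U: "open U"
  shows "emeasure \<mu> U \<le> liminf (\<lambda>n. emeasure (\<mu>s n) U)"
proof (cases "U = UNIV")
  case True
  have "emeasure \<nu> UNIV = 1" if "\<nu> \<in> prob_measures" for \<nu> :: "'a measure"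
    using that prob_space.emeasure_space_1[of \<nu>] sets_eq_imp_space_eq[of \<nu> borel]
    by (auto simp: prob_measures_def)
  then show ?thesis using \<mu>s \<mu> True by (simp add: Liminf_const)
next
  case False
  \<comment> \<open>Here \<open>- U\<close> is nonempty. For \<open>U = UNIV\<close> this would be
    the zero function, as \<open>infdist\<close> to the empty set is 0 by convention; hence the case
    split.\<close>
  define f where "f k x = min 1 (real k * infdist x (- U))" for k x
  have f: "continuous_on UNIV (f k)" "0 \<le> f k x" "f k x \<le> 1" for k x
    by (auto simp: f_def intro!: continuous_intros mult_nonneg_nonneg infdist_nonneg)
  have f_ind: "f k x \<le> indicator U x" for k x
    using f(3)[of k x] by (cases "x \<in> U") (auto simp: f_def indicator_def)
  have fm: "f k \<in> borel_measurable borel" for k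
    using f(1) by (rule borel_measurable_continuous_onI)
  have le: "ennreal (integral\<^sup>L \<nu> (f k)) \<le> emeasure \<nu> U" if "\<nu> \<in> prob_measures" for \<nu> k
  proof -
    interpret prob_space \<nu> using that by (simp add: prob_measures_def)
    have sets[measurable_cong]: "sets \<nu> = sets borel" using that by (simp add: prob_measures_def)
    have "ennreal (integral\<^sup>L \<nu> (f k)) = (\<integral>\<^sup>+x. ennreal (f k x) \<partial>\<nu>)"
      using fm f(2,3)
      by (intro nn_integral_eq_integral[symmetric] integrable_const_bound[where B=1])
         (auto cong: measurable_cong_sets simp: sets)
    also have "\<dots> \<le> (\<integral>\<^sup>+x. indicator U x \<partial>\<nu>)"
      using f_ind by (intro nn_integral_mono) (metis ennreal_indicator ennreal_leI)
    also have "\<dots> = emeasure \<nu> U"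
      using U by (intro nn_integral_indicator) (simp add: sets)
    finally show ?thesis .
  qed
  have "ennreal (integral\<^sup>L \<mu> (f k)) \<le> liminf (\<lambda>n. emeasure (\<mu>s n) U)" for k
  proof -
    have "bounded (range (f k))"
      using f(2,3) by (intro boundedI[where B=1]) auto
    then have "(\<lambda>n. integral\<^sup>L (\<mu>s n) (f k)) \<longlonglongrightarrow> integral\<^sup>L \<mu> (f k)"
      using conv f(1) by (auto simp: weak_conv_seq_def)
    then have "ennreal (integral\<^sup>L \<mu> (f k)) = liminf (\<lambda>n. ennreal (integral\<^sup>L (\<mu>s n) (f k)))"
      by (intro lim_imp_Liminf[symmetric] tendsto_ennrealI) auto
    also have "\<dots> \<le> liminf (\<lambda>n. emeasure (\<mu>s n) U)"
      using le[OF \<mu>s] by (intro Liminf_mono always_eventually) auto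
    finally show ?thesis .
  qed
  moreover have "(\<lambda>k. ennreal (integral\<^sup>L \<mu> (f k))) \<longlonglongrightarrow> emeasure \<mu> U"
  proof -
    interpret prob_space \<mu> using \<mu> by (simp add: prob_measures_def)
    have sets[measurable_cong]: "sets \<mu> = sets borel" using \<mu> by (simp add: prob_measures_def)
    have pt: "(\<lambda>k. f k x) \<longlonglongrightarrow> indicator U x" for x
    proof (cases "x \<in> U")
      case True
      then have pos: "infdist x (- U) > 0"
        using U False in_closed_iff_infdist_zero[of "- U" x] infdist_nonneg[of x "- U"]
        by (auto simp: less_le)
      have "eventually (\<lambda>k. f k x = indicator U x) sequentially"
        using eventually_ge_at_top[of "nat \<lceil>1 / infdist x (- U)\<rceil>"]
      proof eventually_elim
        case (elim k)
        then have "1 / infdist x (- U) \<le> real k" by linarith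
        then show ?case using pos True by (simp add: f_def field_simps)
      qed
      then show ?thesis by (rule tendsto_eventually)
    qed (simp add: f_def)
    have "(\<lambda>k. integral\<^sup>L \<mu> (f k)) \<longlonglongrightarrow> integral\<^sup>L \<mu> (indicator U)"
      using fm f(2,3) pt U
      by (intro integral_dominated_convergence[where w="\<lambda>_. 1"])
         (auto cong: measurable_cong_sets simp: sets)
    then show ?thesis
      using U by (auto simp: emeasure_eq_measure sets intro!: tendsto_ennrealI)
  qed
  ultimately show ?thesis by (intro LIMSEQ_le_const2) auto
qed

text \<open>Both limits integrate bounded continuous functions alike, so each constant sequence
  converges weakly to the other measure. The portmanteau inequality in both directions gives
  equality on open sets, an intersection-stable generator of the Borel sets.\<close>

lemma weak_conv_seq_unique:
  fixes \<mu> \<nu> :: "'a::metric_space measure"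
  assumes \<mu>: "\<mu> \<in> prob_measures" and \<nu>: "\<nu> \<in> prob_measures"
    and conv: "weak_conv_seq \<mu>s \<mu>" "weak_conv_seq \<mu>s \<nu>"
  shows "\<mu> = \<nu>"
proof -
  have eq: "integral\<^sup>L \<mu> f = integral\<^sup>L \<nu> f" if "continuous_on UNIV f" "bounded (range f)" for f :: "'a \<Rightarrow> real"
    using conv that LIMSEQ_unique unfolding weak_conv_seq_def by metis
  have "emeasure \<mu> U = emeasure \<nu> U" if "open U" for U
  proof (rule antisym)
    show "emeasure \<mu> U \<le> emeasure \<nu> U"
      using portmanteau_open[of "\<lambda>_. \<nu>" \<mu> U] \<mu> \<nu> eq that by (auto simp: weak_conv_seq_def Liminf_const)
    show "emeasure \<nu> U \<le> emeasure \<mu> U"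
      using portmanteau_open[of "\<lambda>_. \<mu>" \<nu> U] \<mu> \<nu> eq that by (auto simp: weak_conv_seq_def Liminf_const)
  qed
  then show ?thesis
    using \<mu> \<nu> finite_measure.emeasure_finite[of \<nu>]
    by (intro measure_eqI_generator_eq[where E="Collect open" and \<Omega>=UNIV and A="\<lambda>_. UNIV"])
       (auto simp: prob_measures_def Int_stable_def borel_def prob_space_def)
qed

lemma weak_conv_seq_distr:
  fixes f :: "'a::topological_space \<Rightarrow> 'b::topological_space"
  assumes \<mu>s: "\<And>n. \<mu>s n \<in> prob_measures" and \<mu>: "\<mu> \<in> prob_measures"
    and conv: "weak_conv_seq \<mu>s \<mu>" and f: "continuous_on UNIV f"
  shows "weak_conv_seq (\<lambda>n. distr (\<mu>s n) borel f) (distr \<mu> borel f)"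
  unfolding weak_conv_seq_def
proof (intro allI impI, elim conjE)
  fix g :: "'b \<Rightarrow> real" assume g: "continuous_on UNIV g" "bounded (range g)"
  have eq: "integral\<^sup>L (distr \<nu> borel f) g = (\<integral>x. g (f x) \<partial>\<nu>)" if "\<nu> \<in> prob_measures" for \<nu>
    using that borel_measurable_continuous_onI[OF f] borel_measurable_continuous_onI[OF g(1)]
    by (intro integral_distr) (auto simp: prob_measures_def cong: measurable_cong_sets)
  have "continuous_on UNIV (\<lambda>x. g (f x))"
    by (rule continuous_on_compose2[OF g(1) f]) auto
  moreover have "bounded (range (\<lambda>x. g (f x)))"
    by (rule bounded_subset[OF g(2)]) auto
  ultimately show "(\<lambda>n. integral\<^sup>L (distr (\<mu>s n) borel f) g) \<longlonglongrightarrow> integral\<^sup>L (distr \<mu> borel f) g"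
    using conv eq \<mu>s \<mu> by (simp add: weak_conv_seq_def)
qed

lemma weak_conv_seq_subseq:
  assumes "weak_conv_seq \<mu>s \<mu>" "strict_mono r"
  shows "weak_conv_seq (\<lambda>n. \<mu>s (r n)) \<mu>"
  using assms LIMSEQ_subseq_LIMSEQ[of _ _ r] unfolding weak_conv_seq_def o_def by blast

section \<open>Lower semicontinuity of integrals under weak convergence\<close>

lemma emeasure_lborel_Ioi: "emeasure lborel {a::real<..} = \<infinity>"
proof (rule ccontr)
  assume "emeasure lborel {a<..} \<noteq> \<infinity>"
  then obtain n where n: "emeasure lborel {a<..} < of_nat n"
    using ennreal_Ex_less_of_nat by (auto simp: less_top)
  have "of_nat n = emeasure lborel {a<..a + real n}" by (simp add: ennreal_of_nat_eq_real_of_nat)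
  also have "\<dots> \<le> emeasure lborel {a<..}" by (intro emeasure_mono) auto
  finally show False using n by simp
qed

text \<open>The value \<open>g x\<close> is the length of the set of \<open>t > 0\<close> below it,
  and Tonelli exchanges the integrals. With the strict inequality the level sets are open for lower
  semicontinuous \<open>g\<close>, as the portmanteau inequality requires.\<close>

lemma nn_integral_layer_cake:
  assumes "sigma_finite_measure M" and g[measurable]: "g \<in> borel_measurable M"
  shows "(\<integral>\<^sup>+x. g x \<partial>M) = (\<integral>\<^sup>+t\<in>{0<..}. emeasure M {x\<in>space M. ennreal t < g x} \<partial>lborel)"
proof -
  interpret M: sigma_finite_measure M by fact
  interpret pair_sigma_finite M lborel ..
  have slice: "g x = (\<integral>\<^sup>+t. indicator {t. 0 < t \<and> ennreal t < g x} t \<partial>lborel)" for x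
  proof (cases "g x")
    case (real r)
    have "{t. 0 < t \<and> ennreal t < g x} = {0<..<r}"
      using real by (auto simp: ennreal_less_iff)
    then show ?thesis using real by simp
  next
    case top
    then have "{t. 0 < t \<and> ennreal t < g x} = {0<..}" by auto
    then show ?thesis using top by (simp add: emeasure_lborel_Ioi)
  qed
  have "(\<integral>\<^sup>+x. g x \<partial>M) = (\<integral>\<^sup>+x. \<integral>\<^sup>+t. indicator {t. 0 < t \<and> ennreal t < g x} t \<partial>lborel \<partial>M)"
    using slice by simp
  also have "\<dots> = (\<integral>\<^sup>+t. \<integral>\<^sup>+x. indicator {t. 0 < t \<and> ennreal t < g x} t \<partial>M \<partial>lborel)"
    by (rule Fubini'[symmetric]) measurable
  also have "\<dots> = (\<integral>\<^sup>+t\<in>{0<..}. emeasure M {x\<in>space M. ennreal t < g x} \<partial>lborel)"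
  proof (rule nn_integral_cong)
    fix t :: real
    have "(\<integral>\<^sup>+x. indicator {t. 0 < t \<and> ennreal t < g x} t \<partial>M)
        = (\<integral>\<^sup>+x. indicator {0<..} t * indicator {x\<in>space M. ennreal t < g x} x \<partial>M)"
      by (intro nn_integral_cong) (auto simp: indicator_def)
    also have "\<dots> = indicator {0<..} t * emeasure M {x\<in>space M. ennreal t < g x}"
      by (rule nn_integral_cmult_indicator) measurable
    finally show "(\<integral>\<^sup>+x. indicator {t. 0 < t \<and> ennreal t < g x} t \<partial>M)
        = emeasure M {x\<in>space M. ennreal t < g x} * indicator {0<..} t"
      by (simp add: mult.commute)
  qed
  finally show ?thesis .
qed

lemma lsc_fun_borel_measurable:
  fixes g :: "'a::topological_space \<Rightarrow> 'b::{linorder_topology,second_countable_topology}"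
  assumes "lsc_fun g"
  shows "g \<in> borel_measurable borel"
  using assms by (intro borel_measurableI_le) (auto simp: lsc_fun_def)

lemma usc_fun_borel_measurable:
  fixes g :: "'a::topological_space \<Rightarrow> 'b::{linorder_topology,second_countable_topology}"
  assumes "usc_fun g"
  shows "g \<in> borel_measurable borel"
  using assms by (intro borel_measurableI_ge) (auto simp: usc_fun_def)

text \<open>The portmanteau inequality holds at every level \<open>t\<close> of the layer cake
  formula, and Fatou's lemma in \<open>t\<close> moves the liminf outside.\<close>

lemma nn_integral_lsc_liminf:
  fixes \<mu> :: "'a::metric_space measure"
  assumes \<mu>s: "\<And>n. \<mu>s n \<in> prob_measures" and \<mu>: "\<mu> \<in> prob_measures"
    and conv: "weak_conv_seq \<mu>s \<mu>" and g: "lsc_fun g"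
  shows "(\<integral>\<^sup>+x. g x \<partial>\<mu>) \<le> liminf (\<lambda>n. \<integral>\<^sup>+x. g x \<partial>\<mu>s n)"
proof -
  have open_less: "open {x. ennreal t < g x}" for t
    using g by (auto simp: lsc_fun_def closed_def Compl_eq not_le)
  have cake: "(\<integral>\<^sup>+x. g x \<partial>\<nu>) = (\<integral>\<^sup>+t\<in>{0<..}. emeasure \<nu> {x. ennreal t < g x} \<partial>lborel)"
    if "\<nu> \<in> prob_measures" for \<nu> :: "'a measure"
    using nn_integral_layer_cake[of \<nu> g] lsc_fun_borel_measurable[OF g] that sets_eq_imp_space_eq[of \<nu> borel]
    by (auto simp: prob_measures_def prob_space_def finite_measure_def cong: measurable_cong_sets)
  have meas: "(\<lambda>t. emeasure \<nu> {x. ennreal t < g x} * indicator {0<..} t) \<in> borel_measurable lborel"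
    if "\<nu> \<in> prob_measures" for \<nu> :: "'a measure"
  proof -
    interpret prob_space \<nu> using that by (simp add: prob_measures_def)
    have [measurable]: "g \<in> borel_measurable \<nu>"
      using lsc_fun_borel_measurable[OF g] that by (simp add: prob_measures_def cong: measurable_cong_sets)
    have "(\<lambda>t. emeasure \<nu> {x\<in>space \<nu>. ennreal t < g x} * indicator {0<..} t) \<in> borel_measurable lborel"
      by measurable
    then show ?thesis
      using that sets_eq_imp_space_eq[of \<nu> borel] by (simp add: prob_measures_def)
  qed
  have "(\<integral>\<^sup>+x. g x \<partial>\<mu>) = (\<integral>\<^sup>+t. emeasure \<mu> {x. ennreal t < g x} * indicator {0<..} t \<partial>lborel)"
    by (rule cake[OF \<mu>])
  also have "\<dots> \<le> (\<integral>\<^sup>+t. liminf (\<lambda>n. emeasure (\<mu>s n) {x. ennreal t < g x} * indicator {0<..} t) \<partial>lborel)"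
    using portmanteau_open[OF \<mu>s \<mu> conv open_less]
    by (intro nn_integral_mono) (simp add: indicator_def)
  also have "\<dots> \<le> liminf (\<lambda>n. \<integral>\<^sup>+t. emeasure (\<mu>s n) {x. ennreal t < g x} * indicator {0<..} t \<partial>lborel)"
    using meas[OF \<mu>s] by (rule nn_integral_liminf)
  also have "\<dots> = liminf (\<lambda>n. \<integral>\<^sup>+x. g x \<partial>\<mu>s n)"
    using cake[OF \<mu>s] by simp
  finally show ?thesis .
qed

section \<open>Upper semicontinuity of the expectation\<close>

text \<open>The open sets where \<open>L\<close> is below a natural number cover the space, since
  the value infinity is excluded; the largest number in a finite subcover is a bound.\<close>

lemma usc_fun_bounded_above:
  fixes L :: "'a::topological_space \<Rightarrow> ereal"
  assumes compact: "compact (UNIV :: 'a set)" and L: "usc_fun L" "\<And>x. L x < \<infinity>"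
  obtains M where "0 \<le> M" "\<And>x. L x \<le> ereal M"
proof -
  have op: "open {x. L x < ereal (real n)}" for n :: nat
    using L(1) by (auto simp: usc_fun_def closed_def Compl_eq not_le)
  have ex: "\<exists>n::nat. L x < ereal (real n)" for x
    using less_PInf_Ex_of_nat[of "L x"] L(2)[of x] by auto
  obtain C where C: "finite C" "UNIV \<subseteq> (\<Union>n\<in>C. {x. L x < ereal (real n)})"
    by (rule compactE_image[OF compact, of UNIV "\<lambda>n::nat. {x. L x < ereal (real n)}"])
       (use op ex in auto)
  have "L x \<le> ereal (real (Max C))" for x
  proof -
    obtain n where "n \<in> C" "L x < ereal (real n)" using C(2) by blast
    moreover have "real n \<le> real (Max C)" using C(1) \<open>n \<in> C\<close> by simp
    ultimately show ?thesis by (metis ereal_less_eq(3) less_imp_le order_trans)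
  qed
  then show ?thesis using that[of "real (Max C)"] by simp
qed

text \<open>Replaces the difference of two integrals by one integral of a nonnegative function. The
  pointwise identity M + (negative part) = (positive part) + (M - L) is integrated and
  rearranged.\<close>

lemma ereal_expect_eq_diff:
  assumes Q: "prob_space Q" and L[measurable]: "L \<in> borel_measurable Q"
    and M: "0 \<le> M" "\<And>x. L x \<le> ereal M"
  shows "ereal_expect Q L = ereal M - enn2ereal (\<integral>\<^sup>+x. e2ennreal (ereal M - L x) \<partial>Q)"
proof -
  interpret prob_space Q by fact
  define A B C where "A = (\<integral>\<^sup>+x. e2ennreal (L x) \<partial>Q)" and "B = (\<integral>\<^sup>+x. e2ennreal (- L x) \<partial>Q)"
    and "C = (\<integral>\<^sup>+x. e2ennreal (ereal M - L x) \<partial>Q)"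
  have pt: "ennreal M + e2ennreal (- L x) = e2ennreal (L x) + e2ennreal (ereal M - L x)" for x
  proof (cases "L x")
    case (real r)
    have "r \<le> M" using real M(2)[of x] by simp
    show ?thesis
    proof (cases "r \<ge> 0")
      case True
      then show ?thesis
        using real \<open>r \<le> M\<close> ennreal_plus[of r "M - r"] by (simp add: ennreal_neg)
    next
      case False
      then show ?thesis
        using real M(1) ennreal_plus[of M "- r"] by (simp add: ennreal_neg)
    qed
  qed (use M(2)[of x] in auto)
  have "ennreal M + B = (\<integral>\<^sup>+x. ennreal M + e2ennreal (- L x) \<partial>Q)"
    unfolding B_def by (subst nn_integral_add) (auto simp: emeasure_space_1)
  also have "\<dots> = A + C"
    unfolding pt A_def C_def by (rule nn_integral_add) auto
  finally have eq: "ennreal M + B = A + C" .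
  \<comment> \<open>Finiteness of \<open>A\<close> permits the rearrangement; \<open>B\<close> and
    \<open>C\<close> may be infinite, but only together, and then both sides are minus
    infinity.\<close>
  have "A \<le> (\<integral>\<^sup>+x. ennreal M \<partial>Q)"
    unfolding A_def using M(2) e2ennreal_mono by (intro nn_integral_mono) fastforce
  then have "A \<le> ennreal M" by (simp add: emeasure_space_1)
  then have "enn2ereal A - enn2ereal B = ereal M - enn2ereal C"
    using eq M(1)
    by (cases A; cases B; cases C) (auto simp: top_unique simp flip: ennreal_plus)
  then show ?thesis by (simp add: ereal_expect_def A_def B_def C_def)
qed

text \<open>The function \<open>M - L\<close> is nonnegative and lower semicontinuous, so its
  integral is lower semicontinuous along weak limits, and the expectation is \<open>M\<close> minus
  that integral.\<close>

lemma ereal_expect_usc_weak: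
  fixes L :: "'a::metric_space \<Rightarrow> ereal"
  assumes compact: "compact (UNIV :: 'a set)" and L: "usc_fun L" "\<And>x. L x < \<infinity>"
    and \<mu>s: "\<And>n. \<mu>s n \<in> prob_measures" and \<mu>: "\<mu> \<in> prob_measures"
    and conv: "weak_conv_seq \<mu>s \<mu>" and b: "\<And>n. ereal b \<le> ereal_expect (\<mu>s n) L"
  shows "ereal b \<le> ereal_expect \<mu> L"
proof -
  obtain M where M: "0 \<le> M" "\<And>x. L x \<le> ereal M"
    using usc_fun_bounded_above[OF compact L] by blast
  define g where "g x = e2ennreal (ereal M - L x)" for x
  have expect: "ereal_expect Q L = ereal M - enn2ereal (integral\<^sup>N Q g)" if "Q \<in> prob_measures" for Q
    unfolding g_def using that M usc_fun_borel_measurable[OF L(1)]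
    by (intro ereal_expect_eq_diff) (auto simp: prob_measures_def cong: measurable_cong_sets)
  have "lsc_fun g"
    unfolding lsc_fun_def
  proof
    fix t :: ennreal
    \<comment> \<open>Sublevel sets of \<open>g\<close> are superlevel sets of \<open>L\<close>; for
      infinite \<open>t\<close> the level is minus infinity.\<close>
    have "{x. g x \<le> t} = {x. ereal M - enn2ereal t \<le> L x}"
    proof (rule Collect_cong)
      fix x
      have nn: "0 \<le> ereal M - L x"
        using M(2)[of x] by (cases "L x") auto
      have "g x \<le> t \<longleftrightarrow> ereal M - L x \<le> enn2ereal t"
        unfolding g_def using nn by (metis e2ennreal_enn2ereal e2ennreal_mono enn2ereal_e2ennreal less_eq_ennreal.rep_eq)
      also have "\<dots> \<longleftrightarrow> ereal M - enn2ereal t \<le> L x"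
        by (cases "L x"; cases "enn2ereal t") auto
      finally show "g x \<le> t \<longleftrightarrow> ereal M - enn2ereal t \<le> L x" .
    qed
    then show "closed {x. g x \<le> t}" using L(1) by (simp add: usc_fun_def)
  qed
  have "integral\<^sup>N (\<mu>s n) g \<le> ennreal (M - b)" for n
    using b[of n] expect[OF \<mu>s[of n]]
    by (cases "integral\<^sup>N (\<mu>s n) g") (auto intro: ennreal_leI)
  then have "liminf (\<lambda>n. integral\<^sup>N (\<mu>s n) g) \<le> liminf (\<lambda>n. ennreal (M - b))"
    by (intro Liminf_mono always_eventually) auto
  then have le: "integral\<^sup>N \<mu> g \<le> ennreal (M - b)"
    using nn_integral_lsc_liminf[OF \<mu>s \<mu> conv \<open>lsc_fun g\<close>] by (simp add: Liminf_const)
  \<comment> \<open>As \<open>ennreal\<close> sends negative reals to 0, the bound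
    \<open>ennreal (M - b)\<close> can be read back as a real inequality only once
    \<open>M - b\<close> is known to be nonnegative.\<close>
  have "b \<le> M"
    using b[of 0] expect[OF \<mu>s[of 0]]
    by (cases "integral\<^sup>N (\<mu>s 0) g") auto
  with le show ?thesis
    using expect[OF \<mu>]
    by (cases "integral\<^sup>N \<mu> g") (auto simp: top_unique)
qed

section \<open>Comparison of the small robust balls with the transport ball\<close>

lemma couplings_prob_measures:
  assumes "\<pi> \<in> couplings \<mu> \<nu>"
  shows "\<pi> \<in> prob_measures"
  using assms by (simp add: couplings_def prob_measures_def)

text \<open>The radius \<open>r n * \<epsilon>\<close> shrinks, which forces the divergence term to
  0, whereas the transport term carries the same factor \<open>r n\<close>: after division its bound
  stays near \<open>\<epsilon>\<close> and survives in the limit.\<close>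

lemma robust_ball_limit:
  fixes P :: "'a::polish_space measure"
  assumes compact: "compact (UNIV :: 'a set)" and P: "P \<in> prob_measures"
    and D_conv: "\<And>\<mu>s. (\<forall>n. \<mu>s n \<in> prob_measures) \<Longrightarrow>
                  (\<lambda>n. D (\<mu>s n) P) \<longlonglongrightarrow> 0 \<Longrightarrow> weak_conv_seq \<mu>s P"
    and c: "lsc_fun (\<lambda>z. c (fst z) (snd z))"
    and \<epsilon>: "0 \<le> \<epsilon>"
    and r: "\<And>n. 0 < r n" "r \<longlonglongrightarrow> 0"
    and Q: "\<And>n. D_cost D (\<lambda>x y. ennreal (r n) * c x y) (Q n) P \<le> ennreal (r n * \<epsilon>)"
  obtains k Q' where "strict_mono (k :: nat \<Rightarrow> nat)" "Q' \<in> prob_measures"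
    "weak_conv_seq (\<lambda>n. Q (k n)) Q'" "OT_cost c P Q' \<le> ennreal \<epsilon>"
proof -
  \<comment> \<open>The infima in \<open>D_cost\<close> and \<open>OT_cost\<close> need not be
    attained. The slack makes the bound strict, so that some \<open>\<eta>\<close> and
    \<open>\<pi>\<close> meet it, and vanishes in the limit.\<close>
  define \<delta> where "\<delta> n = \<epsilon> + inverse (real (Suc n))" for n
  have \<delta>_lim: "\<delta> \<longlonglongrightarrow> \<epsilon>"
    unfolding \<delta>_def using tendsto_add[OF tendsto_const LIMSEQ_inverse_real_of_nat] by simp
  have \<delta>_nonneg: "0 \<le> \<delta> n" for n
    using \<epsilon> by (simp add: \<delta>_def)
  have "\<exists>\<eta> \<pi>. \<eta> \<in> prob_measures \<and> \<pi> \<in> couplings \<eta> (Q n) \<and> D \<eta> P \<le> ennreal (r n * \<delta> n)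
      \<and> (\<integral>\<^sup>+z. c (fst z) (snd z) \<partial>\<pi>) \<le> ennreal (\<delta> n)" for n
  proof -
    have "ennreal (r n * \<epsilon>) < ennreal (r n * \<delta> n)"
      using r(1)[of n] \<epsilon> by (intro ennreal_lessI mult_strict_left_mono mult_pos_pos) (auto simp: \<delta>_def intro: add_nonneg_pos)
    with Q[of n] obtain \<eta> where \<eta>: "\<eta> \<in> prob_measures"
        "D \<eta> P + OT_cost (\<lambda>x y. ennreal (r n) * c x y) \<eta> (Q n) < ennreal (r n * \<delta> n)"
      unfolding D_cost_def by (auto simp: INF_less_iff dest!: le_less_trans)
    have D_le: "D \<eta> P \<le> ennreal (r n * \<delta> n)"
      using \<eta>(2) by (metis le_iff_add less_imp_le order_trans)
    have "OT_cost (\<lambda>x y. ennreal (r n) * c x y) \<eta> (Q n) < ennreal (r n * \<delta> n)"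
      using \<eta>(2) by (metis add.commute le_iff_add le_less_trans)
    then obtain \<pi> where \<pi>: "\<pi> \<in> couplings \<eta> (Q n)"
        "(\<integral>\<^sup>+z. ennreal (r n) * c (fst z) (snd z) \<partial>\<pi>) < ennreal (r n * \<delta> n)"
      unfolding OT_cost_def by (auto simp: INF_less_iff)
    have "(\<lambda>z. c (fst z) (snd z)) \<in> borel_measurable \<pi>"
      using lsc_fun_borel_measurable[OF c] \<pi>(1) by (simp add: couplings_def cong: measurable_cong_sets)
    then have "ennreal (r n) * (\<integral>\<^sup>+z. c (fst z) (snd z) \<partial>\<pi>) < ennreal (r n) * ennreal (\<delta> n)"
      using \<pi>(2) r(1)[of n] \<delta>_nonneg[of n] by (simp add: nn_integral_cmult ennreal_mult)
    \<comment> \<open>Division by \<open>r n\<close>, as the contrapositive of monotonicity of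
      multiplication.\<close>
    then have "(\<integral>\<^sup>+z. c (fst z) (snd z) \<partial>\<pi>) \<le> ennreal (\<delta> n)"
      by (meson linorder_not_less mult_left_mono nle_le zero_le)
    then show ?thesis using \<eta>(1) \<pi>(1) D_le by blast
  qed
  then obtain \<eta> \<pi> where \<eta>: "\<And>n. \<eta> n \<in> prob_measures" and \<pi>: "\<And>n. \<pi> n \<in> couplings (\<eta> n) (Q n)"
      and D_le: "\<And>n. D (\<eta> n) P \<le> ennreal (r n * \<delta> n)"
      and cost: "\<And>n. (\<integral>\<^sup>+z. c (fst z) (snd z) \<partial>\<pi> n) \<le> ennreal (\<delta> n)"
    by metis
  have "(\<lambda>n. ennreal (r n * \<delta> n)) \<longlonglongrightarrow> 0"
    using tendsto_ennrealI[OF tendsto_mult[OF r(2) \<delta>_lim]] by simp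
  then have "(\<lambda>n. D (\<eta> n) P) \<longlonglongrightarrow> 0"
    using tendsto_sandwich[of "\<lambda>_. 0" "\<lambda>n. D (\<eta> n) P" sequentially "\<lambda>n. ennreal (r n * \<delta> n)" 0] D_le by simp
  then have \<eta>_conv: "weak_conv_seq \<eta> P" using D_conv \<eta> by blast
  \<comment> \<open>Compactness is applied to the couplings on the product space, so that both
    marginals converge along the same subsequence.\<close>
  have "compact (UNIV :: ('a \<times> 'a) set)"
    using compact_Times[OF compact compact] by (simp add: UNIV_Times_UNIV)
  moreover have \<pi>_prob: "\<pi> n \<in> prob_measures" for n using \<pi> by (rule couplings_prob_measures)
  ultimately obtain k \<pi>' where k: "strict_mono k" and \<pi>': "\<pi>' \<in> prob_measures"
      "weak_conv_seq (\<lambda>n. \<pi> (k n)) \<pi>'"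
    by (rule prob_measures_weak_seq_compact)
  have marg: "distr (\<pi> n) borel fst = \<eta> n" "distr (\<pi> n) borel snd = Q n" for n
    using \<pi>[of n] by (auto simp: couplings_def)
  \<comment> \<open>The first marginals converge both to the first marginal of \<open>\<pi>'\<close>
    and to \<open>P\<close>; uniqueness of weak limits identifies the two.\<close>
  have "weak_conv_seq (\<lambda>n. \<eta> (k n)) (distr \<pi>' borel fst)"
    using weak_conv_seq_distr[OF \<pi>_prob \<pi>', of fst] marg by (simp add: continuous_on_fst)
  moreover have "distr \<pi>' borel fst \<in> prob_measures"
    by (rule prob_measures_distr[OF \<pi>'(1)]) (simp add: borel_measurable_continuous_onI continuous_on_fst)
  ultimately have fst_\<pi>': "distr \<pi>' borel fst = P"
    using weak_conv_seq_unique[OF _ P _ weak_conv_seq_subseq[OF \<eta>_conv k]] by blast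
  define Q' where "Q' = distr \<pi>' borel snd"
  have "\<pi>' \<in> couplings P Q'"
    using \<pi>'(1) fst_\<pi>' by (simp add: couplings_def prob_measures_def Q'_def)
  then have "OT_cost c P Q' \<le> (\<integral>\<^sup>+z. c (fst z) (snd z) \<partial>\<pi>')"
    unfolding OT_cost_def by (rule INF_lower)
  also have "\<dots> \<le> liminf (\<lambda>n. \<integral>\<^sup>+z. c (fst z) (snd z) \<partial>\<pi> (k n))"
    by (rule nn_integral_lsc_liminf[OF \<pi>_prob \<pi>' c])
  also have "\<dots> \<le> liminf (\<lambda>n. ennreal (\<delta> (k n)))"
    using cost by (intro Liminf_mono always_eventually) auto
  also have "\<dots> = ennreal \<epsilon>"
    using LIMSEQ_subseq_LIMSEQ[OF \<delta>_lim k]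
    by (intro lim_imp_Liminf tendsto_ennrealI) (auto simp: o_def)
  finally have "OT_cost c P Q' \<le> ennreal \<epsilon>" .
  moreover have "Q' \<in> prob_measures"
    unfolding Q'_def by (rule prob_measures_distr[OF \<pi>'(1)]) (simp add: borel_measurable_continuous_onI continuous_on_snd)
  moreover have "weak_conv_seq (\<lambda>n. Q (k n)) Q'"
    unfolding Q'_def using weak_conv_seq_distr[OF \<pi>_prob \<pi>', of snd] marg by (simp add: continuous_on_snd)
  ultimately show ?thesis using that k by blast
qed

text \<open>Taking \<open>\<eta> = P\<close> costs no divergence and leaves the transport cost for
  \<open>r * c\<close>, which scales by \<open>r\<close>. Thus the transport ball lies inside every
  robust ball.\<close>

lemma D_cost_le_OT_cost:
  assumes P: "P \<in> prob_measures" and D: "pre_divergence D" and c: "lsc_fun (\<lambda>z. c (fst z) (snd z))"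
    and r: "0 < r" and \<epsilon>: "0 \<le> \<epsilon>" and le: "OT_cost c P Q \<le> ennreal \<epsilon>"
  shows "D_cost D (\<lambda>x y. ennreal r * c x y) Q P \<le> ennreal (r * \<epsilon>)"
proof -
  have "D_cost D (\<lambda>x y. ennreal r * c x y) Q P \<le> D P P + OT_cost (\<lambda>x y. ennreal r * c x y) P Q"
    unfolding D_cost_def using P by (rule INF_lower)
  also have "\<dots> = (INF \<pi>\<in>couplings P Q. \<integral>\<^sup>+z. ennreal r * c (fst z) (snd z) \<partial>\<pi>)"
    using D P by (simp add: pre_divergence_def OT_cost_def)
  also have "\<dots> \<le> ennreal r * ennreal \<epsilon>"
  proof (rule ccontr)
    assume "\<not> ?thesis"
    then have gt: "ennreal (r * \<epsilon>) < (INF \<pi>\<in>couplings P Q. \<integral>\<^sup>+z. ennreal r * c (fst z) (snd z) \<partial>\<pi>)"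
      using r \<epsilon> by (simp add: ennreal_mult not_le)
    \<comment> \<open>An intermediate value is finite, so it can be divided by \<open>r\<close>: a
      coupling of unscaled cost below \<open>b / r\<close> has scaled cost at most \<open>b\<close>,
      contradicting the choice of \<open>b\<close>.\<close>
    then obtain b' where b': "ennreal (r * \<epsilon>) < b'"
        "b' < (INF \<pi>\<in>couplings P Q. \<integral>\<^sup>+z. ennreal r * c (fst z) (snd z) \<partial>\<pi>)"
      using dense by blast
    then obtain b where "b' = ennreal b" "0 \<le> b" by (cases b') auto
    with b' have b: "r * \<epsilon> < b" "ennreal b < (INF \<pi>\<in>couplings P Q. \<integral>\<^sup>+z. ennreal r * c (fst z) (snd z) \<partial>\<pi>)"
      using r \<epsilon> by (auto simp: ennreal_less_iff)
    have "\<epsilon> < b / r" using b(1) r by (simp add: pos_less_divide_eq mult.commute)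
    then have "OT_cost c P Q < ennreal (b / r)"
      using \<epsilon> by (intro le_less_trans[OF le] ennreal_lessI) auto
    then obtain \<pi> where \<pi>: "\<pi> \<in> couplings P Q" "(\<integral>\<^sup>+z. c (fst z) (snd z) \<partial>\<pi>) < ennreal (b / r)"
      unfolding OT_cost_def by (auto simp: INF_less_iff)
    have "(\<lambda>z. c (fst z) (snd z)) \<in> borel_measurable \<pi>"
      using lsc_fun_borel_measurable[OF c] \<pi>(1) by (simp add: couplings_def cong: measurable_cong_sets)
    then have "(\<integral>\<^sup>+z. ennreal r * c (fst z) (snd z) \<partial>\<pi>) = ennreal r * (\<integral>\<^sup>+z. c (fst z) (snd z) \<partial>\<pi>)"
      by (rule nn_integral_cmult)
    also have "\<dots> \<le> ennreal r * ennreal (b / r)"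
      using \<pi>(2) by (intro mult_left_mono) auto
    also have "\<dots> = ennreal b"
      using r by (simp flip: ennreal_mult')
    finally have "(INF \<pi>\<in>couplings P Q. \<integral>\<^sup>+z. ennreal r * c (fst z) (snd z) \<partial>\<pi>) \<le> ennreal b"
      using \<pi>(1) by (rule INF_lower2[rotated])
    then show False using b(2) by simp
  qed
  also have "\<dots> = ennreal (r * \<epsilon>)" using r \<epsilon> by (simp add: ennreal_mult)
  finally show ?thesis .
qed

section \<open>Convergence of the robust suprema and of their infima\<close>

text \<open>The inclusion of balls gives the lower bound for every \<open>r > 0\<close>; it is kept
  as a second conclusion because the infimum over a family needs it uniformly. The upper bound
  follows by contradiction from a weak limit of near-maximizers in shrinking balls.\<close>

lemma robust_sup_tendsto:
  fixes P :: "'a::polish_space measure" and L :: "'a \<Rightarrow> ereal"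
  assumes compact: "compact (UNIV :: 'a set)" and L: "usc_fun L" "\<And>x. L x < \<infinity>"
    and P: "P \<in> prob_measures" and D_pre: "pre_divergence D"
    and D_conv: "\<And>\<mu>s. (\<forall>n. \<mu>s n \<in> prob_measures) \<Longrightarrow>
                  (\<lambda>n. D (\<mu>s n) P) \<longlonglongrightarrow> 0 \<Longrightarrow> weak_conv_seq \<mu>s P"
    and c: "lsc_fun (\<lambda>z. c (fst z) (snd z))"
    and \<epsilon>: "0 \<le> \<epsilon>"
  defines "F \<equiv> \<lambda>r. SUP Q\<in>{Q\<in>prob_measures. D_cost D (\<lambda>x y. ennreal r * c x y) Q P \<le> ennreal (r * \<epsilon>)}.
              ereal_expect Q L"
    and "F0 \<equiv> SUP Q\<in>{Q\<in>prob_measures. OT_cost c P Q \<le> ennreal \<epsilon>}. ereal_expect Q L"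
  shows "(F \<longlongrightarrow> F0) (at_right 0)" and "\<And>r. 0 < r \<Longrightarrow> F0 \<le> F r"
proof -
  show lower: "F0 \<le> F r" if "0 < r" for r
    unfolding F_def F0_def using D_cost_le_OT_cost[OF P D_pre c that \<epsilon>] by (intro SUP_subset_mono) auto
  show "(F \<longlongrightarrow> F0) (at_right 0)"
  proof (rule order_tendstoI)
    fix a assume "a < F0"
    then show "\<forall>\<^sub>F r in at_right 0. a < F r"
      using eventually_at_right_less[of "0::real"] lower by (auto elim!: eventually_mono intro: less_le_trans)
  next
    fix a assume "F0 < a"
    \<comment> \<open>Since suprema need not be attained, a real \<open>b\<close> strictly below
      \<open>a\<close> is what the measures \<open>Q n\<close> are made to exceed; the limit
      \<open>Q'\<close> retains expectation at least \<open>b\<close>, which is still above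
      \<open>F0\<close>.\<close>
    then obtain b where b: "F0 < ereal b" "ereal b < a" using ereal_dense2 by blast
    show "\<forall>\<^sub>F r in at_right 0. F r < a"
    proof (rule ccontr)
      assume not_ev: "\<not> ?thesis"
      have "\<exists>r. 0 < r \<and> r < inverse (real (Suc n)) \<and> a \<le> F r" for n
      proof (rule ccontr)
        assume "\<not> ?thesis"
        then have "\<forall>r>0. r < inverse (real (Suc n)) \<longrightarrow> F r < a" by (auto simp: not_le)
        then have "\<forall>\<^sub>F r in at_right 0. F r < a"
          unfolding eventually_at_right_field by (intro exI[of _ "inverse (real (Suc n))"]) auto
        with not_ev show False ..
      qed
      then obtain r where r: "\<And>n. 0 < r n" "\<And>n. r n < inverse (real (Suc n))" "\<And>n. a \<le> F (r n)"
        by metis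
      have r_lim: "r \<longlonglongrightarrow> 0"
        by (rule tendsto_sandwich[OF _ _ tendsto_const LIMSEQ_inverse_real_of_nat])
           (use r(1,2) in \<open>auto intro!: always_eventually simp: less_imp_le\<close>)
      have "\<exists>Q. Q \<in> prob_measures \<and> D_cost D (\<lambda>x y. ennreal (r n) * c x y) Q P \<le> ennreal (r n * \<epsilon>)
          \<and> ereal b < ereal_expect Q L" for n
        using less_le_trans[OF b(2) r(3)[of n]] unfolding F_def by (auto simp: less_SUP_iff)
      then obtain Q where Q: "\<And>n. Q n \<in> prob_measures"
          "\<And>n. D_cost D (\<lambda>x y. ennreal (r n) * c x y) (Q n) P \<le> ennreal (r n * \<epsilon>)"
          "\<And>n. ereal b < ereal_expect (Q n) L"
        by metis
      obtain k Q' where Q': "strict_mono (k :: nat \<Rightarrow> nat)" "Q' \<in> prob_measures"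
          "weak_conv_seq (\<lambda>n. Q (k n)) Q'" "OT_cost c P Q' \<le> ennreal \<epsilon>"
        using robust_ball_limit[OF compact P D_conv c \<epsilon> r(1) r_lim Q(2)] by metis
      have "ereal b \<le> ereal_expect Q' L"
        using Q(3) by (intro ereal_expect_usc_weak[where \<mu>s="\<lambda>n. Q (k n)", OF compact L Q(1) Q'(2,3)])
          (simp add: less_imp_le)
      also have "\<dots> \<le> F0"
        unfolding F0_def using Q'(2,4) by (intro SUP_upper) auto
      finally show False using b(1) by simp
    qed
  qed
qed

text \<open>Getting below a value \<open>a\<close> takes a single index with limit below
  \<open>a\<close>. Staying above one involves all indices at once, which the common lower bound
  \<open>l i \<le> F i r\<close> handles.\<close>

lemma tendsto_INF_of_ge:
  fixes F :: "'i \<Rightarrow> 'r \<Rightarrow> 'b::{complete_linorder,linorder_topology}"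
  assumes lim: "\<And>i. i \<in> I \<Longrightarrow> (F i \<longlongrightarrow> l i) G"
    and ge: "\<forall>\<^sub>F r in G. \<forall>i\<in>I. l i \<le> F i r"
  shows "((\<lambda>r. INF i\<in>I. F i r) \<longlongrightarrow> (INF i\<in>I. l i)) G"
proof (rule order_tendstoI)
  fix a assume a: "a < (INF i\<in>I. l i)"
  show "\<forall>\<^sub>F r in G. a < (INF i\<in>I. F i r)"
    using ge
  proof eventually_elim
    case (elim r)
    then have "(INF i\<in>I. l i) \<le> (INF i\<in>I. F i r)" by (intro INF_mono) blast
    then show ?case using a by (rule less_le_trans[rotated])
  qed
next
  fix a assume "(INF i\<in>I. l i) < a"
  then obtain i where i: "i \<in> I" "l i < a" by (auto simp: INF_less_iff)
  show "\<forall>\<^sub>F r in G. (INF i\<in>I. F i r) < a"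
    using order_tendstoD(2)[OF lim[OF i(1)] i(2)]
    by eventually_elim (rule le_less_trans[OF INF_lower[OF i(1)]])
qed

theorem theorem8:
  fixes P :: "'a::polish_space measure"
    and D :: "'a measure \<Rightarrow> 'a measure \<Rightarrow> ennreal"
    and c :: "'a \<Rightarrow> 'a \<Rightarrow> ennreal"
    and L :: "'a \<Rightarrow> ereal"
    and \<Theta> :: "'b set"
    and LL :: "'b \<Rightarrow> 'a \<Rightarrow> ereal"
    and \<epsilon> :: real
  assumes compact_X: "compact (UNIV :: 'a set)"
    and L_usc: "usc_fun L" and L_fin: "\<forall>x. L x < \<infinity>"
    and P_prob: "P \<in> prob_measures"
    and D_pre: "pre_divergence D"
    and D_lsc: "\<And>\<mu>s \<mu>. (\<forall>n. \<mu>s n \<in> prob_measures) \<Longrightarrow> \<mu> \<in> prob_measures \<Longrightarrow>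
                  weak_conv_seq \<mu>s \<mu> \<Longrightarrow> D \<mu> P \<le> liminf (\<lambda>n. D (\<mu>s n) P)"
    and D_conv: "\<And>\<mu>s. (\<forall>n. \<mu>s n \<in> prob_measures) \<Longrightarrow>
                  (\<lambda>n. D (\<mu>s n) P) \<longlonglongrightarrow> 0 \<Longrightarrow> weak_conv_seq \<mu>s P"
    and c_lsc: "lsc_fun (\<lambda>z. c (fst z) (snd z))"
    and LL_usc: "\<forall>\<theta>\<in>\<Theta>. usc_fun (LL \<theta>) \<and> (\<forall>x. LL \<theta> x < \<infinity>)"
    and eps_pos: "\<epsilon> > 0"
  shows "((\<lambda>r. SUP Q\<in>{Q\<in>prob_measures. D_cost D (\<lambda>x y. ennreal r * c x y) Q P \<le> ennreal (r * \<epsilon>)}.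
              ereal_expect Q L)
          \<longlongrightarrow> (SUP Q\<in>{Q\<in>prob_measures. OT_cost c P Q \<le> ennreal \<epsilon>}. ereal_expect Q L))
          (at_right 0)
       \<and> ((\<lambda>r. INF \<theta>\<in>\<Theta>. SUP Q\<in>{Q\<in>prob_measures. D_cost D (\<lambda>x y. ennreal r * c x y) Q P \<le> ennreal (r * \<epsilon>)}.
              ereal_expect Q (LL \<theta>))
          \<longlongrightarrow> (INF \<theta>\<in>\<Theta>. SUP Q\<in>{Q\<in>prob_measures. OT_cost c P Q \<le> ennreal \<epsilon>}. ereal_expect Q (LL \<theta>)))
          (at_right 0)"
proof (intro conjI tendsto_INF_of_ge)
  note robust = robust_sup_tendsto[OF compact_X _ _ P_prob D_pre D_conv c_lsc less_imp_le[OF eps_pos]]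
  show "((\<lambda>r. SUP Q\<in>{Q\<in>prob_measures. D_cost D (\<lambda>x y. ennreal r * c x y) Q P \<le> ennreal (r * \<epsilon>)}. ereal_expect Q L)
      \<longlongrightarrow> (SUP Q\<in>{Q\<in>prob_measures. OT_cost c P Q \<le> ennreal \<epsilon>}. ereal_expect Q L)) (at_right 0)"
    using L_usc L_fin by (intro robust(1)) auto
  show "((\<lambda>r. SUP Q\<in>{Q\<in>prob_measures. D_cost D (\<lambda>x y. ennreal r * c x y) Q P \<le> ennreal (r * \<epsilon>)}. ereal_expect Q (LL \<theta>))
      \<longlongrightarrow> (SUP Q\<in>{Q\<in>prob_measures. OT_cost c P Q \<le> ennreal \<epsilon>}. ereal_expect Q (LL \<theta>))) (at_right 0)"
    if "\<theta> \<in> \<Theta>" for \<theta>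
    using LL_usc that by (intro robust(1)) auto
  \<comment> \<open>The inclusion of balls does not involve the integrand, so every
    \<open>r > 0\<close> serves all \<open>\<theta>\<close> simultaneously.\<close>
  show "\<forall>\<^sub>F r in at_right 0. \<forall>\<theta>\<in>\<Theta>.
      (SUP Q\<in>{Q\<in>prob_measures. OT_cost c P Q \<le> ennreal \<epsilon>}. ereal_expect Q (LL \<theta>))
      \<le> (SUP Q\<in>{Q\<in>prob_measures. D_cost D (\<lambda>x y. ennreal r * c x y) Q P \<le> ennreal (r * \<epsilon>)}. ereal_expect Q (LL \<theta>))"
    using eventually_at_right_less[of "0::real"]
  proof eventually_elim
    case (elim r)
    then show ?case using LL_usc by (intro ballI robust(2)) auto
  qed
qed

end
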